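(* Let $\bm\gamma_1=\bm\gamma_0+\bm\lambda/\sqrt n$ with $\bm\lambda\in\mathbb{R}^s$, and assume that there exist $r>0$ and finite constants $M_1,M_2$ such that $h(\bm x;\bm\gamma)$ is twice continuously differentiable with respect to $\bm\gamma\in\mathcal B(\bm\gamma_0,r)$ for all $\bm x\in\mathcal X$, and $$\sup_{\bm x\in\mathcal X}\|\nabla h(\bm x;\bm\gamma_0)\|\le M_1<\infty,\qquad \sup_{\bm x\in\mathcal X}\ \sup_{\bm\gamma\in\mathcal B(\bm\gamma_0,r)}\|h''(\bm x;\bm\gamma)\|_2\le M_2<\infty .$$ Then, for a design $\xi$, the KL-criterion is related to the noncentrality parameter $\zeta$ by $$I_{12}(\xi;\bm\gamma_1)=1+\frac1n\,\zeta(\xi;\bm\lambda;\bm\gamma_0)+O\left(\frac{\|\bm\lambda\|^3}{n^{3/2}}\right)\qquad (n\to\infty).$$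
   Context: Setting. $\mathcal X\subseteq\mathbb{R}^p$ is compact; a design $\xi$ is a discrete (finitely supported) probability measure on $\mathcal X$ with support points $\bm x_1,\dots,\bm x_k$ and weights $\xi(\bm x_i)$. $\mu(\bm x;\bm\beta)$, $\bm\beta\in\mathbb{R}^m$, is a real-valued mean function; $h:\mathbb{R}^p\times\mathbb{R}^s\to\mathbb{R}_+$ is a continuous positive function, and $\bm\gamma_0\in\mathbb{R}^s$ is such that $h(\bm x;\bm\gamma_0)=1$ for all $\bm x$. $\nabla h$ and $h''$ are the gradient and the Hessian of $h$ with respect to $\bm\gamma$; $\mathcal B(\bm\gamma_0,r)$ is the ball of radius $r$ centred at $\bm\gamma_0$; $\|\cdot\|$ is the Euclidean norm and $\|\cdot\|_2$ the spectral norm of a matrix. KL-criterion: for fixed known $\bm\beta_1\in\mathbb{R}^m$, $\sigma_1^2>0$ and $\bm\gamma_1\in\mathbb{R}^s$, $$I_{12}(\xi;\bm\gamma_1)=\min_{\bm\beta\in\mathbb{R}^m,\ \sigma^2>0}\ \sum_{i=1}^k\left(\frac{\sigma_1^2h(\bm x_i;\bm\gamma_1)+[\mu(\bm x_i;\bm\beta_1)-\mu(\bm x_i;\bm\beta)]^2}{\sigma^2}-\log\frac{\sigma_1^2h(\bm x_i;\bm\gamma_1)}{\sigma^2}\right)\xi(\bm x_i).$$ Noncentrality parameter (of the asymptotic chi-squared distribution of a likelihood-based test of $\bm\gamma=\bm\gamma_0$ against $\bm\gamma=\bm\gamma_0+\bm\lambda/\sqrt n$): $$\zeta(\xi;\bm\lambda;\bm\gamma_0)=\frac12\bm\lambda^T\left(\sum_{i=1}^k\nabla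 h(\bm x_i;\bm\gamma_0)\nabla h(\bm x_i;\bm\gamma_0)^T\xi(\bm x_i)-\sum_{i=1}^k\nabla h(\bm x_i;\bm\gamma_0)\xi(\bm x_i)\sum_{i=1}^k\nabla h(\bm x_i;\bm\gamma_0)^T\xi(\bm x_i)\right)\bm\lambda .$$ The $O$-statement is for given $\xi$ and $\bm\lambda$: there are $C$ and $n_0$ such that the remainder is at most $C\|\bm\lambda\|^3/n^{3/2}$ in absolute value for all $n\ge n_0$. *)

theory Defs
  imports "HOL-Probability.Probability" "HOL-Library.Landau_Symbols"
begin

definition grad :: "(real^'s \<Rightarrow> real) \<Rightarrow> real^'s \<Rightarrow> real^'s" where
  "grad f x = (\<chi> i. frechet_derivative f (at x) (axis i 1))"

definition hessian :: "(real^'s \<Rightarrow> real) \<Rightarrow> real^'s \<Rightarrow> real^'s^'s" where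
  "hessian f x = jacobian (grad f) (at x)"

text \<open>Intended for open \<open>S\<close>. Continuity of \<open>f\<close> and of its gradient follows from
  their differentiability.\<close>

definition twice_cont_diff_on :: "(real^'s \<Rightarrow> real) \<Rightarrow> (real^'s) set \<Rightarrow> bool" where
  "twice_cont_diff_on f S \<longleftrightarrow>
     (\<forall>x\<in>S. f differentiable (at x)) \<and>
     (\<forall>x\<in>S. grad f differentiable (at x)) \<and>
     continuous_on S (hessian f)"

definition spectral_norm :: "real^'n^'m \<Rightarrow> real" where
  "spectral_norm A = onorm (\<lambda>v. A *v v)"

text \<open>A design is a finitely supported probability mass function; its support points are
  \<open>set_pmf \<xi>\<close> and the weight of \<open>x\<close> is \<open>pmf \<xi> x\<close>.\<close>

definition design_on :: "'a set \<Rightarrow> 'a pmf \<Rightarrow> bool" where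
  "design_on X \<xi> \<longleftrightarrow> finite (set_pmf \<xi>) \<and> set_pmf \<xi> \<subseteq> X"

text \<open>The arguments \<open>v\<^sub>1\<close> and \<open>v\<close> below are the variances \<open>\<sigma>\<^sub>1\<^sup>2\<close> and \<open>\<sigma>\<^sup>2\<close>.\<close>

definition kl_objective ::
  "('x \<Rightarrow> 'b \<Rightarrow> real) \<Rightarrow> ('x \<Rightarrow> 'c \<Rightarrow> real) \<Rightarrow> 'b \<Rightarrow> real \<Rightarrow>
   'x pmf \<Rightarrow> 'c \<Rightarrow> 'b \<Rightarrow> real \<Rightarrow> real" where
  "kl_objective \<mu> h \<beta>\<^sub>1 v\<^sub>1 \<xi> \<gamma>\<^sub>1 \<beta> v =
     (\<Sum>x\<in>set_pmf \<xi>.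
        ((v\<^sub>1 * h x \<gamma>\<^sub>1 + (\<mu> x \<beta>\<^sub>1 - \<mu> x \<beta>)\<^sup>2) / v - ln (v\<^sub>1 * h x \<gamma>\<^sub>1 / v)) * pmf \<xi> x)"

text \<open>The minimum is a genuine minimum, not an infimum: \<open>LEAST\<close> is only specified when the
  least value is attained.\<close>

definition kl_criterion ::
  "('x \<Rightarrow> 'b \<Rightarrow> real) \<Rightarrow> ('x \<Rightarrow> 'c \<Rightarrow> real) \<Rightarrow> 'b \<Rightarrow> real \<Rightarrow> 'x pmf \<Rightarrow> 'c \<Rightarrow> real" where
  "kl_criterion \<mu> h \<beta>\<^sub>1 v\<^sub>1 \<xi> \<gamma>\<^sub>1 =
     (LEAST y. \<exists>\<beta> v. v > 0 \<and> y = kl_objective \<mu> h \<beta>\<^sub>1 v\<^sub>1 \<xi> \<gamma>\<^sub>1 \<beta> v)"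

definition noncentrality ::
  "('x \<Rightarrow> real^'s \<Rightarrow> real) \<Rightarrow> 'x pmf \<Rightarrow> real^'s \<Rightarrow> real^'s \<Rightarrow> real" where
  "noncentrality h \<xi> l \<gamma>\<^sub>0 =
     (let g = (\<lambda>x. grad (h x) \<gamma>\<^sub>0);
          g_mean = (\<Sum>x\<in>set_pmf \<xi>. pmf \<xi> x *\<^sub>R g x);
          A = (\<Sum>x\<in>set_pmf \<xi>. pmf \<xi> x *\<^sub>R ((columnvector (g x) :: real^1^'s) ** rowvector (g x)))
              - (columnvector g_mean :: real^1^'s) ** rowvector g_mean
      in 1 / 2 * (l \<bullet> (A *v l)))"

end

theory Submission imports Defs "HOL-Real_Asymp.Real_Asymp"
begin

text \<open>
  Since \<open>\<mu>\<close> enters through a square and \<open>ln y \<le> y - 1\<close>, the KL objective is minimal at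
  \<open>\<beta> = \<beta>\<^sub>1\<close>, \<open>v = v\<^sub>1 E[h]\<close>, where \<open>E\<close> is the mean under the design; so the criterion equals
  \<open>1 + ln E[h] - E[ln h]\<close>. Along \<open>\<gamma> = \<gamma>\<^sub>0 + t l\<close> we have \<open>h = 1 + u\<close> with
  \<open>u = t a + O(t\<^sup>2)\<close> and \<open>a = \<nabla>h \<bullet> l\<close>. In \<open>ln (1 + E[u]) - E[ln (1 + u)]\<close> the linear terms
  cancel and \<open>t\<^sup>2 (E[a\<^sup>2] - E[a]\<^sup>2) / 2 + O(t\<^sup>3)\<close> remains, which is \<open>t\<^sup>2\<close> times the
  noncentrality parameter up to \<open>O(t\<^sup>3)\<close>.
\<close>

section \<open>Closed form of the KL-criterion\<close>

lemma sum_pmf_mult_const: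
  fixes c :: real
  assumes "finite (set_pmf p)"
  shows "(\<Sum>x\<in>set_pmf p. c * pmf p x) = c"
  using assms by (simp add: sum_pmf_eq_1 flip: sum_distrib_left)

text \<open>\<open>LEAST\<close> is evaluated by exhibiting a value that is attained and is a lower
  bound, so existence of the minimum is established along the way.\<close>

lemma kl_criterion_eq:
  assumes fin: "finite (set_pmf \<xi>)" and h: "\<And>x. h x \<gamma> > 0" and v1: "v1 > 0"
  shows "kl_criterion \<mu> h \<beta>1 v1 \<xi> \<gamma> =
    1 + ln (\<Sum>x\<in>set_pmf \<xi>. pmf \<xi> x * h x \<gamma>) - (\<Sum>x\<in>set_pmf \<xi>. pmf \<xi> x * ln (h x \<gamma>))"
proof -
  define S where "S = (\<Sum>x\<in>set_pmf \<xi>. pmf \<xi> x * h x \<gamma>)"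
  define L where "L = (\<Sum>x\<in>set_pmf \<xi>. pmf \<xi> x * ln (h x \<gamma>))"
  define D where "D = (\<lambda>\<beta>. \<Sum>x\<in>set_pmf \<xi>. pmf \<xi> x * (\<mu> x \<beta>1 - \<mu> x \<beta>)\<^sup>2)"
  have S: "S > 0"
    unfolding S_def using fin h by (intro sum_pos) (auto simp: pmf_positive set_pmf_not_empty)
  have D: "D \<beta> \<ge> 0" for \<beta>
    unfolding D_def by (intro sum_nonneg) auto
  have obj: "kl_objective \<mu> h \<beta>1 v1 \<xi> \<gamma> \<beta> v = v1 * S / v + D \<beta> / v - ln v1 + ln v - L"
    if v: "v > 0" for \<beta> v
  proof -
    have "kl_objective \<mu> h \<beta>1 v1 \<xi> \<gamma> \<beta> v =
      (\<Sum>x\<in>set_pmf \<xi>. (v1 / v) * (pmf \<xi> x * h x \<gamma>) + (1 / v) * (pmf \<xi> x * (\<mu> x \<beta>1 - \<mu> x \<beta>)\<^sup>2)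
        + (ln v - ln v1) * pmf \<xi> x - pmf \<xi> x * ln (h x \<gamma>))"
      unfolding kl_objective_def
    proof (intro sum.cong refl)
      fix x
      have ln_eq: "ln (v1 * h x \<gamma> / v) = ln v1 + ln (h x \<gamma>) - ln v"
        using v v1 h[of x] by (simp add: ln_mult ln_div)
      show "((v1 * h x \<gamma> + (\<mu> x \<beta>1 - \<mu> x \<beta>)\<^sup>2) / v - ln (v1 * h x \<gamma> / v)) * pmf \<xi> x =
        (v1 / v) * (pmf \<xi> x * h x \<gamma>) + (1 / v) * (pmf \<xi> x * (\<mu> x \<beta>1 - \<mu> x \<beta>)\<^sup>2)
        + (ln v - ln v1) * pmf \<xi> x - pmf \<xi> x * ln (h x \<gamma>)"
        unfolding ln_eq using v by (simp add: field_simps)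
    qed
    also have "\<dots> = (v1 / v) * S + (1 / v) * D \<beta> + (ln v - ln v1) - L"
      unfolding sum.distrib sum_subtractf sum_pmf_mult_const[OF fin] S_def D_def L_def
      by (simp add: sum_distrib_left)
    finally show ?thesis by simp
  qed
  show ?thesis
    unfolding kl_criterion_def S_def[symmetric] L_def[symmetric]
  proof (rule Least_equality)
    have "D \<beta>1 = 0" unfolding D_def by simp
    \<comment> \<open>The witness \<open>v1 * S\<close> is the critical point of
      \<open>v1 * S / v + ln v\<close>, which is all that depends on \<open>v\<close> once
      \<open>D\<close> vanishes.\<close>
    hence "1 + ln S - L = kl_objective \<mu> h \<beta>1 v1 \<xi> \<gamma> \<beta>1 (v1 * S)"
      using obj[of "v1 * S" \<beta>1] S v1 by (simp add: ln_mult)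
    thus "\<exists>\<beta> v. v > 0 \<and> 1 + ln S - L = kl_objective \<mu> h \<beta>1 v1 \<xi> \<gamma> \<beta> v"
      using S v1 by (meson mult_pos_pos)
  next
    fix y assume "\<exists>\<beta> v. v > 0 \<and> y = kl_objective \<mu> h \<beta>1 v1 \<xi> \<gamma> \<beta> v"
    then obtain \<beta> v where v: "v > 0" and y: "y = v1 * S / v + D \<beta> / v - ln v1 + ln v - L"
      using obj by metis
    \<comment> \<open>This rearranges to \<open>1 + ln S \<le> v1 * S / v - ln v1 + ln v\<close>;
      the residual term \<open>D \<beta> / v\<close> can only raise the objective.\<close>
    have "ln (v1 * S / v) \<le> v1 * S / v - 1"
      using S v1 v by (intro ln_le_minus_one) auto
    moreover have "ln (v1 * S / v) = ln v1 + ln S - ln v"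
      using S v1 v by (simp add: ln_mult ln_div)
    moreover have "D \<beta> / v \<ge> 0" using D v by simp
    ultimately show "1 + ln S - L \<le> y" unfolding y by linarith
  qed
qed

section \<open>Noncentrality parameter as a variance\<close>

lemma inner_outer_product:
  fixes g l :: "real^'s"
  shows "l \<bullet> (((columnvector g :: real^1^'s) ** rowvector g) *v l) = (g \<bullet> l)\<^sup>2"
proof -
  have "((columnvector g :: real^1^'s) ** rowvector g) *v l = (g \<bullet> l) *\<^sub>R g"
    by (simp add: vec_eq_iff matrix_matrix_mult_def matrix_vector_mult_def columnvector_def
        rowvector_def inner_vec_def sum_distrib_right sum_distrib_left mult_ac)
  thus ?thesis by (simp add: power2_eq_square inner_commute)
qed

lemma sum_matrix_vector:
  "(\<Sum>x\<in>T. A x) *v l = (\<Sum>x\<in>T. A x *v l)" for A :: "'a \<Rightarrow> real^'n^'m"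
  by (induction T rule: infinite_finite_induct) (simp_all add: matrix_vector_mult_add_rdistrib)

text \<open>Each rank-one matrix contributes the square of an inner product, so the quadratic form
  is half the variance, under the design, of the directional derivative
  \<open>grad (h x) \<gamma> \<bullet> l\<close>.\<close>

lemma noncentrality_eq:
  "noncentrality h \<xi> l \<gamma> =
    1 / 2 * ((\<Sum>x\<in>set_pmf \<xi>. pmf \<xi> x * (grad (h x) \<gamma> \<bullet> l)\<^sup>2)
             - (\<Sum>x\<in>set_pmf \<xi>. pmf \<xi> x * (grad (h x) \<gamma> \<bullet> l))\<^sup>2)"
  by (simp add: noncentrality_def Let_def matrix_vector_mult_diff_rdistrib inner_diff_right
      inner_outer_product sum_matrix_vector inner_sum_right inner_sum_left
      flip: scaleR_matrix_vector_assoc)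

section \<open>First-order expansion along a ray\<close>

lemma frechet_derivative_eq_grad:
  assumes "f differentiable (at x)"
  shows "frechet_derivative f (at x) v = grad f x \<bullet> v"
proof -
  interpret linear "frechet_derivative f (at x)"
    using assms by (rule linear_frechet_derivative)
  have "frechet_derivative f (at x) v = frechet_derivative f (at x) (\<Sum>i\<in>UNIV. (v $ i) *\<^sub>R axis i 1)"
    by (metis basis_expansion scalar_mult_eq_scaleR)
  also have "\<dots> = grad f x \<bullet> v"
    by (simp add: sum scale grad_def inner_vec_def mult.commute)
  finally show ?thesis .
qed

text \<open>By the mean value theorem the increment is \<open>t * \<phi>' z\<close> with
  \<open>0 < z < t\<close>. Differentiability of the gradient at \<open>c\<close> makes
  \<open>\<phi>' z - \<phi>' 0\<close> of order \<open>z\<close>, which supplies the second factor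
  \<open>t\<close>.\<close>

lemma twice_cont_diff_line_expansion:
  fixes f :: "real^'s \<Rightarrow> real"
  assumes f: "twice_cont_diff_on f (ball c r)" and r: "r > 0"
  shows "(\<lambda>t. f (c + t *\<^sub>R l) - f c - t * (grad f c \<bullet> l)) \<in> O[at_right 0](\<lambda>t. t ^ 2)"
proof -
  define \<phi>' where "\<phi>' = (\<lambda>t. grad f (c + t *\<^sub>R l) \<bullet> l)"
  have cont: "(\<lambda>t::real. c + t *\<^sub>R l) \<midarrow>0\<rightarrow> c"
    by (auto intro!: tendsto_eq_intros)
  have "\<forall>\<^sub>F t in at 0. c + t *\<^sub>R l \<in> ball c r"
    by (rule topological_tendstoD[OF cont]) (use r in auto)
  then obtain d where d: "d > 0" "\<And>t. 0 < t \<Longrightarrow> t < d \<Longrightarrow> c + t *\<^sub>R l \<in> ball c r"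
    unfolding eventually_at by (auto simp: dist_real_def)
  \<comment> \<open>The endpoint \<open>t = 0\<close> is included because the mean value theorem is
    applied on the closed interval from 0 to \<open>t\<close>.\<close>
  have der: "((\<lambda>t. f (c + t *\<^sub>R l)) has_real_derivative \<phi>' t) (at t)" if t: "0 \<le> t" "t < d" for t
  proof -
    have "c + t *\<^sub>R l \<in> ball c r" using d(2)[of t] t r by (cases "t = 0") auto
    hence diff: "f differentiable (at (c + t *\<^sub>R l))"
      using f unfolding twice_cont_diff_on_def by blast
    have "((\<lambda>t. f (c + t *\<^sub>R l)) has_derivative
        (\<lambda>s. frechet_derivative f (at (c + t *\<^sub>R l)) (s *\<^sub>R l))) (at t)"
      by (rule has_derivative_compose[where g = f and f = "\<lambda>t. c + t *\<^sub>R l" and x = t])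
         (use diff in \<open>auto intro!: derivative_eq_intros simp flip: frechet_derivative_works\<close>)
    thus ?thesis
      unfolding has_field_derivative_def frechet_derivative_eq_grad[OF diff] \<phi>'_def
      by (simp add: mult.commute[of _ "_ \<bullet> _"] fun_eq_iff)
  qed
  have "grad f differentiable (at c)"
    using f r unfolding twice_cont_diff_on_def by auto
  \<comment> \<open>The point is written \<open>c + 0 *\<^sub>R l\<close> to match the form in which
    the chain rule at 0 expects it.\<close>
  hence "(grad f has_derivative frechet_derivative (grad f) (at (c + 0 *\<^sub>R l))) (at (c + 0 *\<^sub>R l))"
    by (simp add: frechet_derivative_works)
  hence "((\<lambda>t::real. grad f (c + t *\<^sub>R l)) has_derivative
      (\<lambda>s. frechet_derivative (grad f) (at (c + 0 *\<^sub>R l)) (s *\<^sub>R l))) (at 0)"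
    by (intro has_derivative_compose[where g = "grad f" and f = "\<lambda>t. c + t *\<^sub>R l" and x = 0])
       (auto intro!: derivative_eq_intros)
  hence "(\<lambda>t::real. grad f (c + t *\<^sub>R l)) differentiable (at 0)"
    by (auto simp: differentiable_def)
  hence "\<phi>' differentiable (at 0)"
    unfolding \<phi>'_def by (intro differentiable_inner) auto
  then obtain D where "(\<phi>' has_real_derivative D) (at 0)"
    by (metis real_differentiableE)
  hence "((\<lambda>t. (\<phi>' t - \<phi>' 0) / t) \<longlongrightarrow> D) (at 0)"
    by (simp add: has_field_derivative_iff)
  \<comment> \<open>The tolerance 1 is arbitrary: any fixed one bounds the difference quotient near
    0, here by \<open>\<bar>D\<bar> + 1\<close>.\<close>
  hence "\<forall>\<^sub>F t in at 0. dist ((\<phi>' t - \<phi>' 0) / t) D < 1"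
    by (rule tendstoD) simp
  then obtain e where e: "e > 0"
      "\<And>t. 0 < t \<Longrightarrow> t < e \<Longrightarrow> dist ((\<phi>' t - \<phi>' 0) / t) D < 1"
    unfolding eventually_at by (auto simp: dist_real_def)
  have lip: "\<bar>\<phi>' t - \<phi>' 0\<bar> \<le> (\<bar>D\<bar> + 1) * t" if "0 < t" "t < e" for t
  proof -
    have "\<bar>(\<phi>' t - \<phi>' 0) / t\<bar> \<le> \<bar>D\<bar> + 1"
      using e(2)[OF that] by (simp add: dist_real_def)
    thus ?thesis using that by (simp add: abs_divide field_simps)
  qed
  have bound: "norm (f (c + t *\<^sub>R l) - f c - t * (grad f c \<bullet> l)) \<le> (\<bar>D\<bar> + 1) * norm (t ^ 2)"
    if t: "0 < t" "t < min d e" for t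
  proof -
    have "\<exists>z>0. z < t \<and> f (c + t *\<^sub>R l) - f (c + 0 *\<^sub>R l) = (t - 0) * \<phi>' z"
      by (rule MVT2) (use t der in auto)
    then obtain z where z: "0 < z" "z < t" "f (c + t *\<^sub>R l) - f c = t * \<phi>' z"
      by auto
    have "\<phi>' 0 = grad f c \<bullet> l" by (simp add: \<phi>'_def)
    hence "f (c + t *\<^sub>R l) - f c - t * (grad f c \<bullet> l) = t * (\<phi>' z - \<phi>' 0)"
      using z by (simp add: algebra_simps)
    also have "norm \<dots> = t * \<bar>\<phi>' z - \<phi>' 0\<bar>" using t by (simp add: abs_mult)
    also have "\<dots> \<le> t * ((\<bar>D\<bar> + 1) * z)"
      using lip[of z] z t by (intro mult_left_mono) auto
    also have "\<dots> \<le> t * ((\<bar>D\<bar> + 1) * t)"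
      using z t by (intro mult_left_mono) auto
    finally show ?thesis by (simp add: power2_eq_square mult_ac)
  qed
  have "min d e > 0" using d e by simp
  hence "\<forall>\<^sub>F t in at_right 0. t \<in> {0<..<min d e}"
    by (rule eventually_at_right_real)
  hence "\<forall>\<^sub>F t in at_right 0. norm (f (c + t *\<^sub>R l) - f c - t * (grad f c \<bullet> l))
      \<le> (\<bar>D\<bar> + 1) * norm (t ^ 2)"
    by eventually_elim (use bound in auto)
  thus ?thesis by (rule bigoI)
qed

section \<open>Expansion of the logarithm\<close>

text \<open>The filter is \<open>nhds 0\<close>, not \<open>at 0\<close>, because the function later
  substituted for \<open>u\<close> may take the value 0. Both sides vanish there, so the punctured
  estimate extends to the point itself.\<close>

lemma ln_one_plus_bigo: "(\<lambda>u::real. ln (1 + u) - (u - u\<^sup>2 / 2)) \<in> O[nhds 0](\<lambda>u. u ^ 3)"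
proof -
  have "(\<lambda>u::real. ln (1 + u) - (u - u\<^sup>2 / 2)) \<in> O[at_left 0](\<lambda>u. u ^ 3)"
       "(\<lambda>u::real. ln (1 + u) - (u - u\<^sup>2 / 2)) \<in> O[at_right 0](\<lambda>u. u ^ 3)"
    by real_asymp+
  hence "(\<lambda>u::real. ln (1 + u) - (u - u\<^sup>2 / 2)) \<in> O[at 0](\<lambda>u. u ^ 3)"
    unfolding at_eq_sup_left_right by (rule landau_o.big.sup)
  then obtain C where "\<forall>\<^sub>F u in at 0. norm (ln (1 + u) - (u - u\<^sup>2 / 2)) \<le> C * norm (u ^ 3 :: real)"
    by (auto elim: landau_o.bigE)
  hence "\<forall>\<^sub>F u in nhds 0. norm (ln (1 + u) - (u - u\<^sup>2 / 2)) \<le> C * norm (u ^ 3 :: real)"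
    unfolding eventually_nhds_conv_at by simp
  thus ?thesis by (rule bigoI)
qed

text \<open>Factor the difference as \<open>(u t - t * a) * (u t + t * a)\<close>: the first factor
  is of order \<open>t ^ 2\<close>, the second of order \<open>t\<close>.\<close>

lemma square_expansion:
  assumes "(\<lambda>t. u t - t * a) \<in> O[at_right 0](\<lambda>t::real. t ^ 2)"
  shows "(\<lambda>t. (u t)\<^sup>2 - t\<^sup>2 * a\<^sup>2) \<in> O[at_right 0](\<lambda>t::real. t ^ 3)"
proof -
  have t2: "(\<lambda>t::real. t\<^sup>2) \<in> O[at_right 0](\<lambda>t. t)"
    and ta: "(\<lambda>t::real. 2 * t * a) \<in> O[at_right 0](\<lambda>t. t)"
    by real_asymp simp
  have "(\<lambda>t. (u t - t * a) + 2 * t * a) \<in> O[at_right 0](\<lambda>t. t)"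
    by (rule sum_in_bigo(1)[OF landau_o.big_trans[OF assms t2] ta])
  from landau_o.big.mult[OF assms this] show ?thesis
    by (simp add: algebra_simps power2_eq_square power3_eq_cube)
qed

text \<open>Only the quadratic term is replaced by its leading part. The linear term stays as the
  exact \<open>u t\<close>, so that it can later cancel without any error.\<close>

lemma ln_expansion:
  assumes u: "(\<lambda>t. u t - t * a) \<in> O[at_right 0](\<lambda>t::real. t ^ 2)"
  shows "(\<lambda>t. ln (1 + u t) - (u t - t\<^sup>2 * a\<^sup>2 / 2)) \<in> O[at_right 0](\<lambda>t::real. t ^ 3)"
proof -
  have t2: "(\<lambda>t::real. t\<^sup>2) \<in> O[at_right 0](\<lambda>t. t)"
    and ta: "(\<lambda>t::real. t * a) \<in> O[at_right 0](\<lambda>t. t)"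
    by real_asymp simp
  have "(\<lambda>t. (u t - t * a) + t * a) \<in> O[at_right 0](\<lambda>t. t)"
    by (rule sum_in_bigo(1)[OF landau_o.big_trans[OF u t2] ta])
  hence ut: "u \<in> O[at_right 0](\<lambda>t. t)" by simp
  also have "(\<lambda>t::real. t) \<in> o[at_right 0](\<lambda>t. 1)" by real_asymp
  finally have "(u \<longlongrightarrow> 0) (at_right 0)"
    using smalloD_tendsto by fastforce
  \<comment> \<open>Since \<open>u\<close> tends to 0, it may be substituted into the expansion of
    the logarithm; \<open>u\<close> being of order \<open>t\<close> then turns the cubic error into
    one in \<open>t\<close>.\<close>
  from landau_o.big.compose[OF ln_one_plus_bigo this]
  have "(\<lambda>t. ln (1 + u t) - (u t - (u t)\<^sup>2 / 2)) \<in> O[at_right 0](\<lambda>t. u t ^ 3)" .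
  also have "(\<lambda>t. u t ^ 3) \<in> O[at_right 0](\<lambda>t. t ^ 3)"
    using ut by (rule landau_o.big_power)
  finally have cubic: "(\<lambda>t. ln (1 + u t) - (u t - (u t)\<^sup>2 / 2)) \<in> O[at_right 0](\<lambda>t. t ^ 3)" .
  have "(\<lambda>t. (1 / 2) * ((u t)\<^sup>2 - t\<^sup>2 * a\<^sup>2)) \<in> O[at_right 0](\<lambda>t. t ^ 3)"
    using square_expansion[OF u] by simp
  from sum_in_bigo(2)[OF cubic this] show ?thesis
    by (simp add: diff_divide_distrib right_diff_distrib diff_diff_eq2 add_diff_eq)
qed

section \<open>Expansion of the KL-criterion\<close>

text \<open>\<open>ln_expansion\<close> is used twice: at each support point with slope
  \<open>a x\<close>, and for the averaged perturbation \<open>E (\<lambda>x. u x t)\<close> with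
  slope \<open>E a\<close>. Subtracting the mean of the former from the latter leaves the variance
  of \<open>a\<close>.\<close>

lemma kl_expansion:
  fixes h :: "'x \<Rightarrow> real^'s \<Rightarrow> real" and \<gamma>0 l :: "real^'s"
  assumes fin: "finite (set_pmf \<xi>)" and h: "\<And>x \<gamma>. h x \<gamma> > 0" and h0: "\<And>x. h x \<gamma>0 = 1"
    and v1: "v1 > 0" and r: "r > 0"
    and diff: "\<And>x. x \<in> set_pmf \<xi> \<Longrightarrow> twice_cont_diff_on (h x) (ball \<gamma>0 r)"
  shows "(\<lambda>t. kl_criterion \<mu> h \<beta>1 v1 \<xi> (\<gamma>0 + t *\<^sub>R l) - (1 + t\<^sup>2 * noncentrality h \<xi> l \<gamma>0))
    \<in> O[at_right 0](\<lambda>t. t ^ 3)"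
proof -
  define a where "a = (\<lambda>x. grad (h x) \<gamma>0 \<bullet> l)"
  define u where "u = (\<lambda>x t. h x (\<gamma>0 + t *\<^sub>R l) - 1)"
  define E where "E = (\<lambda>f. \<Sum>x\<in>set_pmf \<xi>. pmf \<xi> x * f x)"
  have E_add: "E (\<lambda>x. f x + g x) = E f + E g" for f g
    by (simp add: E_def sum.distrib algebra_simps)
  have E_diff: "E (\<lambda>x. f x - g x) = E f - E g" for f g
    by (simp add: E_def sum_subtractf algebra_simps)
  have E_cmult: "E (\<lambda>x. c * f x) = c * E f" for f c
    by (simp add: E_def sum_distrib_left mult_ac)
  have E_const: "E (\<lambda>x. c) = c" for c
    using sum_pmf_mult_const[OF fin, of c] by (simp add: E_def mult.commute)
  \<comment> \<open>The constants may differ between support points, since a finite weighted sum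
    preserves the order.\<close>
  have E_bigo: "(\<lambda>t. E (\<lambda>x. f x t)) \<in> O[at_right 0](g)"
    if "\<And>x. x \<in> set_pmf \<xi> \<Longrightarrow> f x \<in> O[at_right 0](g)" for f and g :: "real \<Rightarrow> real"
    unfolding E_def by (intro big_sum_in_bigo) (simp add: that)
  have u: "(\<lambda>t. u x t - t * a x) \<in> O[at_right 0](\<lambda>t. t ^ 2)" if "x \<in> set_pmf \<xi>" for x
    using twice_cont_diff_line_expansion[OF diff[OF that] r, of l] by (simp add: u_def a_def h0)
  have "(\<lambda>t. E (\<lambda>x. u x t - t * a x)) \<in> O[at_right 0](\<lambda>t. t ^ 2)"
    by (rule E_bigo[OF u])
  hence mean: "(\<lambda>t. E (\<lambda>x. u x t) - t * E a) \<in> O[at_right 0](\<lambda>t. t ^ 2)"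
    by (simp add: E_diff E_cmult)
  have "(\<lambda>t. E (\<lambda>x. ln (1 + u x t) - (u x t - t\<^sup>2 * (a x)\<^sup>2 / 2))) \<in> O[at_right 0](\<lambda>t. t ^ 3)"
    by (intro E_bigo ln_expansion u)
  from sum_in_bigo(2)[OF ln_expansion[OF mean] this]
  have "(\<lambda>t. ln (1 + E (\<lambda>x. u x t)) - (E (\<lambda>x. u x t) - t\<^sup>2 * (E a)\<^sup>2 / 2)
      - E (\<lambda>x. ln (1 + u x t) - (u x t - t\<^sup>2 * (a x)\<^sup>2 / 2))) \<in> O[at_right 0](\<lambda>t. t ^ 3)" .
  \<comment> \<open>An exact identity for every \<open>t\<close>: the two copies of
    \<open>E (\<lambda>x. u x t)\<close> cancel, and the closed form of the criterion holds at every
    parameter because \<open>h\<close> is positive.\<close>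
  also have "(\<lambda>t. ln (1 + E (\<lambda>x. u x t)) - (E (\<lambda>x. u x t) - t\<^sup>2 * (E a)\<^sup>2 / 2)
      - E (\<lambda>x. ln (1 + u x t) - (u x t - t\<^sup>2 * (a x)\<^sup>2 / 2))) =
    (\<lambda>t. kl_criterion \<mu> h \<beta>1 v1 \<xi> (\<gamma>0 + t *\<^sub>R l) - (1 + t\<^sup>2 * noncentrality h \<xi> l \<gamma>0))"
  proof
    fix t
    have L: "E (\<lambda>x. ln (1 + u x t) - (u x t - t\<^sup>2 * (a x)\<^sup>2 / 2)) =
        E (\<lambda>x. ln (1 + u x t)) - E (\<lambda>x. u x t) + t\<^sup>2 / 2 * E (\<lambda>x. (a x)\<^sup>2)"
      using E_cmult[of "t\<^sup>2 / 2" "\<lambda>x. (a x)\<^sup>2"] by (simp add: E_diff)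
    have K: "kl_criterion \<mu> h \<beta>1 v1 \<xi> (\<gamma>0 + t *\<^sub>R l) =
        1 + ln (1 + E (\<lambda>x. u x t)) - E (\<lambda>x. ln (1 + u x t))"
    proof -
      have "1 + E (\<lambda>x. u x t) = E (\<lambda>x. 1 + u x t)" by (simp only: E_add E_const)
      thus ?thesis
        by (simp add: kl_criterion_eq[of \<xi> h, OF fin h v1]) (simp add: E_def u_def)
    qed
    have N: "noncentrality h \<xi> l \<gamma>0 = 1 / 2 * (E (\<lambda>x. (a x)\<^sup>2) - (E a)\<^sup>2)"
      by (simp add: noncentrality_eq E_def a_def)
    show "ln (1 + E (\<lambda>x. u x t)) - (E (\<lambda>x. u x t) - t\<^sup>2 * (E a)\<^sup>2 / 2)
      - E (\<lambda>x. ln (1 + u x t) - (u x t - t\<^sup>2 * (a x)\<^sup>2 / 2)) =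
      kl_criterion \<mu> h \<beta>1 v1 \<xi> (\<gamma>0 + t *\<^sub>R l) - (1 + t\<^sup>2 * noncentrality h \<xi> l \<gamma>0)"
      unfolding L K N by (simp add: field_simps)
  qed
  finally show ?thesis .
qed

theorem theorem4:
  fixes X :: "(real^'p) set"
    and \<mu> :: "real^'p \<Rightarrow> real^'m \<Rightarrow> real"
    and h :: "real^'p \<Rightarrow> real^'s \<Rightarrow> real"
    and \<beta>\<^sub>1 :: "real^'m" and v\<^sub>1 :: real
    and \<gamma>\<^sub>0 l :: "real^'s"
    and \<xi> :: "(real^'p) pmf"
    and r M\<^sub>1 M\<^sub>2 :: real
  assumes "compact X"
    and "design_on X \<xi>"
    and "continuous_on UNIV (\<lambda>(x, \<gamma>). h x \<gamma>)"
    and "\<And>x \<gamma>. h x \<gamma> > 0"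
    and "\<And>x. h x \<gamma>\<^sub>0 = 1"
    and "v\<^sub>1 > 0"
    and "r > 0"
    and "\<And>x. x \<in> X \<Longrightarrow> twice_cont_diff_on (h x) (ball \<gamma>\<^sub>0 r)"
    and "\<And>x. x \<in> X \<Longrightarrow> norm (grad (h x) \<gamma>\<^sub>0) \<le> M\<^sub>1"
    and "\<And>x \<gamma>. x \<in> X \<Longrightarrow> \<gamma> \<in> ball \<gamma>\<^sub>0 r \<Longrightarrow> spectral_norm (hessian (h x) \<gamma>) \<le> M\<^sub>2"
  shows "(\<lambda>n::nat. kl_criterion \<mu> h \<beta>\<^sub>1 v\<^sub>1 \<xi> (\<gamma>\<^sub>0 + (1 / sqrt (real n)) *\<^sub>R l)
                    - (1 + 1 / real n * noncentrality h \<xi> l \<gamma>\<^sub>0))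
         \<in> O(\<lambda>n. norm l ^ 3 / real n powr (3 / 2))"
proof -
  have fin: "finite (set_pmf \<xi>)" and supp: "set_pmf \<xi> \<subseteq> X"
    using assms(2) by (auto simp: design_on_def)
  show ?thesis
  proof (cases "l = 0")
    \<comment> \<open>The claimed bound is 0 here, so the remainder has to vanish
      identically.\<close>
    case True
    have "kl_criterion \<mu> h \<beta>\<^sub>1 v\<^sub>1 \<xi> \<gamma>\<^sub>0 = 1"
      using kl_criterion_eq[of \<xi> h \<gamma>\<^sub>0, OF fin assms(4,6)] fin by (simp add: assms(5) sum_pmf_eq_1)
    moreover have "noncentrality h \<xi> 0 \<gamma>\<^sub>0 = 0" by (simp add: noncentrality_eq)
    ultimately show ?thesis using True by simp
  next
    case False
    have "(\<lambda>t. kl_criterion \<mu> h \<beta>\<^sub>1 v\<^sub>1 \<xi> (\<gamma>\<^sub>0 + t *\<^sub>R l) - (1 + t\<^sup>2 * noncentrality h \<xi> l \<gamma>\<^sub>0))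
        \<in> O[at_right 0](\<lambda>t. t ^ 3)"
      by (rule kl_expansion[of \<xi> h, OF fin assms(4,5,6,7)]) (use supp assms(8) in auto)
    \<comment> \<open>Substituting \<open>t = 1 / sqrt n\<close> turns \<open>t\<^sup>2\<close> into
      \<open>1 / n\<close> and \<open>t ^ 3\<close> into \<open>n\<close> to the power -3/2.\<close>
    moreover have "filterlim (\<lambda>n. 1 / sqrt (real n)) (at_right 0) sequentially"
      by real_asymp
    ultimately have "(\<lambda>n. kl_criterion \<mu> h \<beta>\<^sub>1 v\<^sub>1 \<xi> (\<gamma>\<^sub>0 + (1 / sqrt (real n)) *\<^sub>R l)
          - (1 + (1 / sqrt (real n))\<^sup>2 * noncentrality h \<xi> l \<gamma>\<^sub>0))
        \<in> O(\<lambda>n. (1 / sqrt (real n)) ^ 3)"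
      by (rule landau_o.big.compose)
    also have "(\<lambda>n. (1 / sqrt (real n)) ^ 3) \<in> O(\<lambda>n. 1 / real n powr (3 / 2))"
      by real_asymp
    \<comment> \<open>For fixed nonzero \<open>l\<close> the factor \<open>norm l ^ 3\<close> is a
      positive constant, so it is inserted at the cost of its reciprocal.\<close>
    also have "(\<lambda>n. 1 / real n powr (3 / 2)) \<in> O(\<lambda>n. norm l ^ 3 * (1 / real n powr (3 / 2)))"
      by (rule bigoI[of _ "1 / norm l ^ 3"]) (use False in auto)
    finally show ?thesis by (simp add: power_divide)
  qed
qed

end
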